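(* Consider the composite problem $\min_{x\in E} F(x)=f(x)+R(x)$ described in the context. (i) Suppose that either Assumption A or Assumption B (see context) holds, and let $\mathcal A$ be a weak regularized proximal Newton oracle (WRPNO) with parameter $C_{\mathcal A}\ge 0$. Let $(x_t)_{t\ge 1}$ be a sequence with $x_1\in\mathrm{dom}(R)$ (the initialization point of Assumption A in case Assumption A is the one that holds) and, for all $t\ge 1$, $$x_{t+1}=\begin{cases}\mathcal A(x_t,1) & \text{if } F(\mathcal A(x_t,1))<F(x_t),\\ x_t&\text{otherwise.}\end{cases}$$ Then for all $t\ge 1$, $$F(x_{t+1})-F^*\le \frac{2\sqrt2}{\alpha^{3/2}}\left(C_{\mathcal A}+\frac{\beta_2}{3}\right)\left(F(x_t)-F^*\right)^{3/2}.$$ (ii) Suppose that Assumption A holds, and let $\mathcal A$ instead be a (non-regularized) weak proximal Newton oracle (WPNO) with parameter $C_{\mathcal A}\ge0$. Let $(x_t)_{t\ge 1}$ be a sequence with $x_1\in\mathrm{dom}(R)$ the initialization point of Assumption A and, for all $t\ge 1$, $x_{t+1}=\mathcal A(x_t,1)$ if $F(\mathcal A(x_t,1))<F(x_t)$, and $x_{t+1}=x_t$ otherwise. Then the resulting sequence satisfies, for all $t\ge1$, $$F(x_{t+1})-F^*\le \frac{2\sqrt2}{\alpha^{3/2}}\left(\frac{5\beta_2}{6}+C_{\mathcal A}+\frac{1000\,\beta_2\beta^3}{3\alpha^3}\right)(F(x_t)-F^* )^{3/2}+\frac{64\,\beta_2C_{\mathcal A}^3}{3\alpha^6}\left(F(x_t)-F^*\right)^3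 .$$
   Context: $E$ is a Euclidean vector space of dimension $n$ with inner product $\langle\cdot,\cdot\rangle$ and Euclidean norm $\|\cdot\|$ (for linear operators, $\|\cdot\|$ is the induced operator norm). $R:E\to(-\infty,\infty]$ is a proper closed convex function, $f$ is convex and twice continuously differentiable over $\mathrm{dom}(R)$, and $\|\nabla^2f(x)-\nabla^2f(y)\|\le\beta_2\|x-y\|$ for all $x,y\in\mathrm{dom}(R)$. $F=f+R$ is bounded below, with optimal value $F^*$ and unique minimizer $x^*$ (existence and uniqueness follow from Assumption A, and uniqueness is part of Assumption B). Assumption A: given an initialization point $x_1\in\mathrm{dom}(R)$, there are $\alpha,\beta>0$ such that for every $x$ in the level set $\mathcal L_1=\{x\in E: F(x)\le F(x_1)\}$ it holds that $\beta I\succeq\nabla^2f(x)\succeq\alpha I$. Assumption B: $\mathrm{dom}(R)$ is bounded with Euclidean diameter $D<\infty$, and quadratic growth holds with some $\alpha>0$: for all $x\in\mathrm{dom}(R)$, $\|x-x^*\|^2\le\frac2\alpha(F(x)-F^* )$, where $x^*$ is the unique minimizer of $F$. For $x\in\mathrm{dom}(R)$ and $\eta\ge 0$ define $$\phi_{x,\eta}(w)=\langle w-x,\nabla f(x)\rangle+\frac\eta2\langle w-x,\nabla^2f(x)(w-x)\rangle+R(w),\qquad \phi^r_{x,\eta}(w)=\phi_{x,\eta}(w)+\frac{\eta^2\beta_2}{6}\|w-x\|^3 .$$ A map $\mathcal A:\mathrm{dom}(R)\times\mathbb R_+\to\mathrm{dom}(R)$ is a weak proximal Newton oracle (WPNO)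 with parameter $C_{\mathcal A}\ge0$ if for every input $(x,\eta)$ its output $v=\mathcal A(x,\eta)$ satisfies $\phi_{x,\eta}(v)\le\phi_{x,\eta}(x^* )+\eta^2C_{\mathcal A}\|x-x^*\|^3$. It is a weak regularized proximal Newton oracle (WRPNO) with parameter $C_{\mathcal A}\ge 0$ if for every input its output satisfies $\phi^r_{x,\eta}(v)\le\phi^r_{x,\eta}(x^* )+\eta^2C_{\mathcal A}\|x-x^*\|^3$. *)

theory Defs
  imports "HOL-Analysis.Analysis"
begin

definition edom :: "('a \<Rightarrow> ereal) \<Rightarrow> 'a set" where
  "edom R = {x. R x < \<infinity>}"

definition ereal_epigraph :: "('a \<Rightarrow> ereal) \<Rightarrow> ('a \<times> real) set" where
  "ereal_epigraph R = {(x, r). R x \<le> ereal r}"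

definition proper_closed_convex :: "('a::euclidean_space \<Rightarrow> ereal) \<Rightarrow> bool" where
  "proper_closed_convex R \<longleftrightarrow>
     (\<forall>x. R x \<noteq> -\<infinity>) \<and> edom R \<noteq> {} \<and>
     closed (ereal_epigraph R) \<and> convex (ereal_epigraph R)"

definition grad :: "('a::euclidean_space \<Rightarrow> real) \<Rightarrow> 'a \<Rightarrow> 'a" where
  "grad f x = (THE g. GDERIV f x :> g)"

text \<open>The Hessian is a bounded linear operator, so \<open>norm\<close> on it is the operator norm and
  continuity refers to the operator-norm topology.\<close>

definition hess :: "('a::euclidean_space \<Rightarrow> real) \<Rightarrow> 'a \<Rightarrow> 'a \<Rightarrow>\<^sub>L 'a" where
  "hess f x = Blinfun (frechet_derivative (grad f) (at x))"

text \<open>The set \<open>S\<close> need not be open. Derivatives are full (two-sided) derivatives in the ambient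
  space, taken at the points of \<open>S\<close>; in particular this holds if \<open>f\<close> is twice continuously
  differentiable on an open set containing \<open>S\<close>. The values of \<open>f\<close> away from \<open>S\<close> are irrelevant.\<close>

definition twice_cont_diff_over :: "('a::euclidean_space \<Rightarrow> real) \<Rightarrow> 'a set \<Rightarrow> bool" where
  "twice_cont_diff_over f S \<longleftrightarrow>
     (\<forall>x\<in>S. (\<forall>\<^sub>F y in nhds x. f differentiable (at y)) \<and> grad f differentiable (at x)) \<and>
     continuous_on S (hess f)"

definition loewner_le :: "('a::euclidean_space \<Rightarrow>\<^sub>L 'a) \<Rightarrow> ('a \<Rightarrow>\<^sub>L 'a) \<Rightarrow> bool" where
  "loewner_le A B \<longleftrightarrow>
     (\<forall>v w. blinfun_apply (B - A) v \<bullet> w = v \<bullet> blinfun_apply (B - A) w) \<and>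
     (\<forall>v. 0 \<le> v \<bullet> blinfun_apply (B - A) v)"

definition objective :: "('a \<Rightarrow> real) \<Rightarrow> ('a \<Rightarrow> ereal) \<Rightarrow> 'a \<Rightarrow> ereal" where
  "objective f R x = ereal (f x) + R x"

definition opt_value :: "('a \<Rightarrow> real) \<Rightarrow> ('a \<Rightarrow> ereal) \<Rightarrow> ereal" where
  "opt_value f R = (INF x. objective f R x)"

text \<open>Meaningful when the minimizer exists and is unique. \<open>assumption_B\<close> below contains both;
  under \<open>assumption_A\<close> both follow from strong convexity on a compact level set.\<close>

definition minimizer :: "('a \<Rightarrow> real) \<Rightarrow> ('a \<Rightarrow> ereal) \<Rightarrow> 'a" where
  "minimizer f R = (ARG_MIN (objective f R) x. True)"

definition composite_problem ::
    "('a::euclidean_space \<Rightarrow> real) \<Rightarrow> ('a \<Rightarrow> ereal) \<Rightarrow> real \<Rightarrow> bool" where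
  "composite_problem f R \<beta>2 \<longleftrightarrow>
     proper_closed_convex R \<and>
     convex_on (edom R) f \<and>
     twice_cont_diff_over f (edom R) \<and>
     (\<forall>x\<in>edom R. \<forall>y\<in>edom R. norm (hess f x - hess f y) \<le> \<beta>2 * norm (x - y)) \<and>
     (\<exists>m::real. \<forall>x. ereal m \<le> objective f R x)"

definition assumption_A ::
    "('a::euclidean_space \<Rightarrow> real) \<Rightarrow> ('a \<Rightarrow> ereal) \<Rightarrow> 'a \<Rightarrow> real \<Rightarrow> real \<Rightarrow> bool" where
  "assumption_A f R x1 \<alpha> \<beta> \<longleftrightarrow>
     x1 \<in> edom R \<and> \<alpha> > 0 \<and> \<beta> > 0 \<and>
     (\<forall>x. objective f R x \<le> objective f R x1 \<longrightarrow>
        loewner_le (hess f x) (\<beta> *\<^sub>R id_blinfun) \<and>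
        loewner_le (\<alpha> *\<^sub>R id_blinfun) (hess f x))"

definition assumption_B ::
    "('a::euclidean_space \<Rightarrow> real) \<Rightarrow> ('a \<Rightarrow> ereal) \<Rightarrow> real \<Rightarrow> bool" where
  "assumption_B f R \<alpha> \<longleftrightarrow>
     bounded (edom R) \<and> \<alpha> > 0 \<and>
     (\<exists>!x. is_arg_min (objective f R) (\<lambda>_. True) x) \<and>
     (\<forall>x\<in>edom R. ereal ((norm (x - minimizer f R))\<^sup>2)
        \<le> ereal (2 / \<alpha>) * (objective f R x - opt_value f R))"

definition prox_model ::
    "('a::euclidean_space \<Rightarrow> real) \<Rightarrow> ('a \<Rightarrow> ereal) \<Rightarrow> 'a \<Rightarrow> real \<Rightarrow> 'a \<Rightarrow> ereal" where
  "prox_model f R x \<eta> w =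
     ereal ((w - x) \<bullet> grad f x + \<eta> / 2 * ((w - x) \<bullet> blinfun_apply (hess f x) (w - x))) + R w"

definition reg_prox_model ::
    "('a::euclidean_space \<Rightarrow> real) \<Rightarrow> ('a \<Rightarrow> ereal) \<Rightarrow> real \<Rightarrow> 'a \<Rightarrow> real \<Rightarrow> 'a \<Rightarrow> ereal" where
  "reg_prox_model f R \<beta>2 x \<eta> w =
     prox_model f R x \<eta> w + ereal (\<eta>\<^sup>2 * \<beta>2 / 6 * norm (w - x) ^ 3)"

definition WPNO ::
    "('a::euclidean_space \<Rightarrow> real) \<Rightarrow> ('a \<Rightarrow> ereal) \<Rightarrow> real \<Rightarrow> ('a \<Rightarrow> real \<Rightarrow> 'a) \<Rightarrow> bool" where
  "WPNO f R C \<A> \<longleftrightarrow> C \<ge> 0 \<and>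
     (\<forall>x\<in>edom R. \<forall>\<eta>\<ge>0. \<A> x \<eta> \<in> edom R \<and>
        prox_model f R x \<eta> (\<A> x \<eta>)
          \<le> prox_model f R x \<eta> (minimizer f R)
             + ereal (\<eta>\<^sup>2 * C * norm (x - minimizer f R) ^ 3))"

definition WRPNO ::
    "('a::euclidean_space \<Rightarrow> real) \<Rightarrow> ('a \<Rightarrow> ereal) \<Rightarrow> real \<Rightarrow> real \<Rightarrow> ('a \<Rightarrow> real \<Rightarrow> 'a) \<Rightarrow> bool" where
  "WRPNO f R \<beta>2 C \<A> \<longleftrightarrow> C \<ge> 0 \<and>
     (\<forall>x\<in>edom R. \<forall>\<eta>\<ge>0. \<A> x \<eta> \<in> edom R \<and>
        reg_prox_model f R \<beta>2 x \<eta> (\<A> x \<eta>)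
          \<le> reg_prox_model f R \<beta>2 x \<eta> (minimizer f R)
             + ereal (\<eta>\<^sup>2 * C * norm (x - minimizer f R) ^ 3))"

text \<open>Iterates are indexed from 1; the value at index 0 is unconstrained.\<close>

definition newton_iterates ::
    "('a \<Rightarrow> real) \<Rightarrow> ('a \<Rightarrow> ereal) \<Rightarrow> ('a \<Rightarrow> real \<Rightarrow> 'a) \<Rightarrow> (nat \<Rightarrow> 'a) \<Rightarrow> bool" where
  "newton_iterates f R \<A> x \<longleftrightarrow>
     x 1 \<in> edom R \<and>
     (\<forall>t\<ge>1. x (Suc t) =
        (if objective f R (\<A> (x t) 1) < objective f R (x t) then \<A> (x t) 1 else x t))"

text \<open>On \<open>edom R\<close>, when \<open>objective f R\<close> is bounded below, the gap is finite, so that taking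
  \<open>real_of_ereal\<close> of it there loses nothing.\<close>

definition gap :: "('a \<Rightarrow> real) \<Rightarrow> ('a \<Rightarrow> ereal) \<Rightarrow> 'a \<Rightarrow> ereal" where
  "gap f R x = objective f R x - opt_value f R"

end

theory Submission
  imports Defs
begin

text \<open>Write \<open>\<rho> = \<parallel>x\<^sub>t - x\<^sup>*\<parallel>\<close> and \<open>v = \<A> x\<^sub>t 1\<close>. Along a segment in the domain the second-order
  Taylor expansion of \<open>f\<close> is exact up to \<open>\<beta>\<^sub>2/6\<close> times the cubed length, so comparing the models at
  \<open>v\<close> and \<open>x\<^sup>*\<close> gives \<open>F v - F\<^sup>* \<le> (C + \<beta>\<^sub>2/3) \<rho>\<^sup>3\<close> for the regularized oracle; quadratic growth turns
  \<open>\<rho>\<^sup>3\<close> into a power \<open>3/2\<close> of the gap. Under Assumption A the minimizer exists and quadratic growth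
  holds because \<open>F\<close> is strongly convex on the convex level set. Without the regularization there
  remains the term \<open>\<beta>\<^sub>2/6 \<parallel>v - x\<^sub>t\<parallel>\<^sup>3\<close>. First-order optimality of \<open>x\<^sup>*\<close> and the bounds on the Hessian
  give a quadratic inequality for \<open>\<parallel>v - x\<^sub>t\<parallel>\<close>, whence
  \<open>\<parallel>v - x\<^sub>t\<parallel> \<le> 3(\<beta>/\<alpha>) \<rho> + (C/\<alpha>) \<rho>\<^sup>2 / 2\<close>.\<close>

section \<open>Taylor expansion along segments\<close>

text \<open>Subtracting from \<open>g\<close> the slope at 0 and the cubic with second derivative
  \<open>a + b * s\<close> leaves a function with zero slope at 0 and nonpositive second derivative;
  monotonicity is applied first to its derivative, then to the function.\<close>

lemma second_derivative_upper:
  fixes g g1 g2 :: "real \<Rightarrow> real"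
  assumes g: "\<And>s. 0 \<le> s \<Longrightarrow> s \<le> 1 \<Longrightarrow> (g has_real_derivative g1 s) (at s)"
    and g1: "\<And>s. 0 \<le> s \<Longrightarrow> s \<le> 1 \<Longrightarrow> (g1 has_real_derivative g2 s) (at s)"
    and bound: "\<And>s. 0 \<le> s \<Longrightarrow> s \<le> 1 \<Longrightarrow> g2 s \<le> a + b * s"
  shows "g 1 \<le> g 0 + g1 0 + a / 2 + b / 6"
proof -
  define p where "p s = g s - g1 0 * s - a / 2 * s\<^sup>2 - b / 6 * s ^ 3" for s
  define p1 where "p1 s = g1 s - g1 0 - a * s - b / 2 * s\<^sup>2" for s
  have p: "(p has_real_derivative p1 s) (at s)" if "0 \<le> s" "s \<le> 1" for s
    unfolding p_def p1_def
    by (auto intro!: derivative_eq_intros g that simp: power2_eq_square)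
  have p1: "(p1 has_real_derivative (g2 s - a - b * s)) (at s)" if "0 \<le> s" "s \<le> 1" for s
    unfolding p1_def by (auto intro!: derivative_eq_intros g1 that)
  have p1_le: "p1 s \<le> 0" if s: "0 \<le> s" "s \<le> 1" for s
  proof -
    have "p1 s \<le> p1 0"
    proof (rule DERIV_nonpos_imp_nonincreasing[OF s(1)])
      fix u assume "0 \<le> u" "u \<le> s"
      then show "\<exists>y. (p1 has_real_derivative y) (at u) \<and> y \<le> 0"
        using p1[of u] bound[of u] s by force
    qed
    then show ?thesis by (simp add: p1_def)
  qed
  have "p 1 \<le> p 0"
    by (rule DERIV_nonpos_imp_nonincreasing) (use p p1_le in force)+
  then show ?thesis by (simp add: p_def)
qed

text \<open>The derivative is a linear functional, represented by the vector of its values on the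
  basis. Uniqueness of this vector makes the \<open>THE\<close> in \<open>grad\<close> pick it
  out.\<close>

lemma differentiable_imp_GDERIV_grad:
  fixes f :: "'a::euclidean_space \<Rightarrow> real"
  assumes "f differentiable (at z)"
  shows "GDERIV f z :> grad f z"
proof -
  let ?D = "frechet_derivative f (at z)"
  have D: "(f has_derivative ?D) (at z)"
    using assms by (simp add: frechet_derivative_works)
  then have lin: "linear ?D"
    by (rule has_derivative_linear)
  define d where "d = (\<Sum>b\<in>Basis. ?D b *\<^sub>R b)"
  have "?D h = h \<bullet> d" for h
  proof -
    have "?D h = ?D (\<Sum>b\<in>Basis. (h \<bullet> b) *\<^sub>R b)"
      by (simp add: euclidean_representation)
    also have "\<dots> = (\<Sum>b\<in>Basis. (h \<bullet> b) * ?D b)"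
      by (simp add: linear_sum[OF lin] linear_scale[OF lin])
    also have "\<dots> = h \<bullet> d"
      by (simp add: d_def inner_sum_right mult.commute)
    finally show ?thesis .
  qed
  then have "GDERIV f z :> d"
    using D unfolding gderiv_def by presburger
  then show ?thesis
    unfolding grad_def
  proof (rule theI)
    fix e assume "GDERIV f z :> e"
    then have "(\<lambda>h. h \<bullet> e) = (\<lambda>h. h \<bullet> d)"
      using has_derivative_unique \<open>GDERIV f z :> d\<close> unfolding gderiv_def by blast
    then show "e = d" by (meson vector_eq_ldot)
  qed
qed

lemma convex_line_mem:
  fixes T :: "'a::real_vector set"
  assumes "convex T" "y \<in> T" "z \<in> T" "0 \<le> s" "s \<le> 1"
  shows "y + s *\<^sub>R (z - y) \<in> T"
proof -
  have "y + s *\<^sub>R (z - y) = (1 - s) *\<^sub>R y + s *\<^sub>R z" by (simp add: algebra_simps)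
  then show ?thesis using assms by (simp add: convex_alt)
qed

context
  fixes f :: "'a::euclidean_space \<Rightarrow> real" and S :: "'a set"
  assumes tcd: "twice_cont_diff_over f S"
begin

lemma GDERIV_grad: "z \<in> S \<Longrightarrow> GDERIV f z :> grad f z"
  using tcd unfolding twice_cont_diff_over_def
  by (blast intro: differentiable_imp_GDERIV_grad dest: eventually_nhds_x_imp_x)

lemma grad_has_derivative_hess:
  assumes "z \<in> S"
  shows "(grad f has_derivative blinfun_apply (hess f z)) (at z)"
proof -
  have "grad f differentiable (at z)"
    using tcd assms unfolding twice_cont_diff_over_def by blast
  then have D: "(grad f has_derivative frechet_derivative (grad f) (at z)) (at z)"
    by (simp add: frechet_derivative_works)
  then have "blinfun_apply (hess f z) = frechet_derivative (grad f) (at z)"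
    unfolding hess_def by (intro bounded_linear_Blinfun_apply has_derivative_bounded_linear)
  then show ?thesis using D by simp
qed

lemma isCont_on_dom: "z \<in> S \<Longrightarrow> isCont f z"
  using GDERIV_grad has_derivative_continuous unfolding gderiv_def by blast

lemma line_derivative:
  assumes "y + s *\<^sub>R d \<in> S"
  shows "((\<lambda>s. f (y + s *\<^sub>R d)) has_real_derivative d \<bullet> grad f (y + s *\<^sub>R d)) (at s)"
proof -
  have "((\<lambda>s. y + s *\<^sub>R d) has_derivative (\<lambda>h. h *\<^sub>R d)) (at s)"
    by (auto intro!: derivative_eq_intros)
  moreover have "(f has_derivative (\<lambda>h. h \<bullet> grad f (y + s *\<^sub>R d))) (at (y + s *\<^sub>R d))"
    using GDERIV_grad[OF assms] unfolding gderiv_def .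
  ultimately show ?thesis
    unfolding has_field_derivative_def
    by (rule has_derivative_eq_rhs[OF has_derivative_compose]) (simp add: fun_eq_iff mult.commute)
qed

lemma line_derivative_grad:
  assumes "y + s *\<^sub>R d \<in> S"
  shows "((\<lambda>s. u \<bullet> grad f (y + s *\<^sub>R d)) has_real_derivative
     u \<bullet> blinfun_apply (hess f (y + s *\<^sub>R d)) d) (at s)"
proof -
  have "((\<lambda>s. y + s *\<^sub>R d) has_derivative (\<lambda>h. h *\<^sub>R d)) (at s)"
    by (auto intro!: derivative_eq_intros)
  from has_derivative_compose[OF this grad_has_derivative_hess[OF assms]]
  have "((\<lambda>s. u \<bullet> grad f (y + s *\<^sub>R d)) has_derivative
     (\<lambda>h. u \<bullet> blinfun_apply (hess f (y + s *\<^sub>R d)) (h *\<^sub>R d))) (at s)"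
    by (rule has_derivative_inner_right)
  then show ?thesis
    unfolding has_field_derivative_def
    by (rule has_derivative_eq_rhs) (simp add: fun_eq_iff blinfun.scaleR_right mult.commute)
qed

lemma taylor_upper:
  assumes "convex T" "T \<subseteq> S" "y \<in> T" "z \<in> T"
    and bound: "\<And>s. 0 \<le> s \<Longrightarrow> s \<le> 1 \<Longrightarrow>
      (z - y) \<bullet> blinfun_apply (hess f (y + s *\<^sub>R (z - y))) (z - y) \<le> a + b * s"
  shows "f z \<le> f y + (z - y) \<bullet> grad f y + a / 2 + b / 6"
proof -
  have mem: "y + s *\<^sub>R (z - y) \<in> S" if "0 \<le> s" "s \<le> 1" for s
    using convex_line_mem[OF assms(1,3,4) that] assms(2) by blast
  have "f (y + 1 *\<^sub>R (z - y)) \<le> f (y + 0 *\<^sub>R (z - y)) + (z - y) \<bullet> grad f (y + 0 *\<^sub>R (z - y))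
     + a / 2 + b / 6"
    by (rule second_derivative_upper[OF line_derivative[OF mem] line_derivative_grad[OF mem] bound])
  then show ?thesis by simp
qed

text \<open>The one-dimensional estimate is applied to \<open>- f\<close> along the segment.
  \<open>T\<close> may be smaller than \<open>S\<close> because strong convexity, the case
  \<open>b = 0\<close>, is available only on a level set.\<close>

lemma taylor_lower:
  assumes "convex T" "T \<subseteq> S" "y \<in> T" "z \<in> T"
    and bound: "\<And>s. 0 \<le> s \<Longrightarrow> s \<le> 1 \<Longrightarrow>
      a + b * s \<le> (z - y) \<bullet> blinfun_apply (hess f (y + s *\<^sub>R (z - y))) (z - y)"
  shows "f y + (z - y) \<bullet> grad f y + a / 2 + b / 6 \<le> f z"
proof -
  have mem: "y + s *\<^sub>R (z - y) \<in> S" if "0 \<le> s" "s \<le> 1" for s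
    using convex_line_mem[OF assms(1,3,4) that] assms(2) by blast
  have "- f (y + 1 *\<^sub>R (z - y)) \<le> - f (y + 0 *\<^sub>R (z - y)) + - ((z - y) \<bullet> grad f (y + 0 *\<^sub>R (z - y)))
     + (- a) / 2 + (- b) / 6"
    by (rule second_derivative_upper[OF
          DERIV_minus[OF line_derivative[OF mem]] DERIV_minus[OF line_derivative_grad[OF mem]]])
       (use bound in \<open>auto simp: le_minus_iff algebra_simps\<close>)
  then show ?thesis by simp
qed

text \<open>Along the segment the quadratic form of the Hessian departs from its value at
  \<open>y\<close> by at most \<open>(\<beta>2 * norm d ^ 3) * s\<close>; integrating twice turns
  this slope into a sixth of it.\<close>

lemma cubic_taylor:
  assumes "convex S" "y \<in> S" "z \<in> S"
    and lip: "\<And>u w. u \<in> S \<Longrightarrow> w \<in> S \<Longrightarrow> norm (hess f u - hess f w) \<le> \<beta>2 * norm (u - w)"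
  shows "\<bar>f z - (f y + (z - y) \<bullet> grad f y + (z - y) \<bullet> blinfun_apply (hess f y) (z - y) / 2)\<bar>
     \<le> \<beta>2 / 6 * norm (z - y) ^ 3"
proof -
  define d where "d = z - y"
  have mem: "y + s *\<^sub>R d \<in> S" if "0 \<le> s" "s \<le> 1" for s
    using convex_line_mem[OF assms(1-3) that] by (simp add: d_def)
  have "\<bar>d \<bullet> blinfun_apply (hess f (y + s *\<^sub>R d)) d - d \<bullet> blinfun_apply (hess f y) d\<bar>
     \<le> (\<beta>2 * norm d ^ 3) * s" if s: "0 \<le> s" "s \<le> 1" for s
  proof -
    have "\<bar>d \<bullet> blinfun_apply (hess f (y + s *\<^sub>R d)) d - d \<bullet> blinfun_apply (hess f y) d\<bar>
       = \<bar>d \<bullet> blinfun_apply (hess f (y + s *\<^sub>R d) - hess f y) d\<bar>"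
      by (simp add: blinfun.diff_left inner_diff_right)
    also have "\<dots> \<le> norm d * norm (blinfun_apply (hess f (y + s *\<^sub>R d) - hess f y) d)"
      by (rule Cauchy_Schwarz_ineq2)
    also have "\<dots> \<le> norm d * (norm (hess f (y + s *\<^sub>R d) - hess f y) * norm d)"
      by (intro mult_left_mono norm_blinfun norm_ge_zero)
    also have "\<dots> \<le> norm d * (\<beta>2 * norm (s *\<^sub>R d) * norm d)"
      using lip[OF mem[OF s] assms(2)] by (intro mult_left_mono mult_right_mono) auto
    also have "\<dots> = (\<beta>2 * norm d ^ 3) * s"
      using s by (simp add: power3_eq_cube)
    finally show ?thesis .
  qed
  note bnd = this[unfolded abs_le_iff, folded d_def]
  have "f z \<le> f y + (z - y) \<bullet> grad f y + (d \<bullet> blinfun_apply (hess f y) d) / 2 + (\<beta>2 * norm d ^ 3) / 6"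
    by (rule taylor_upper[OF assms(1) order_refl assms(2,3)])
       (use bnd in \<open>force simp flip: d_def\<close>)
  moreover have "f y + (z - y) \<bullet> grad f y + (d \<bullet> blinfun_apply (hess f y) d) / 2 + (- (\<beta>2 * norm d ^ 3)) / 6 \<le> f z"
    by (rule taylor_lower[OF assms(1) order_refl assms(2,3)])
       (use bnd in \<open>force simp flip: d_def\<close>)
  ultimately show ?thesis
    unfolding d_def by linarith
qed

end

section \<open>Convexity and quadratic forms\<close>

lemma real_of_ereal_eq_on_edom:
  assumes "proper_closed_convex R" "z \<in> edom R"
  shows "R z = ereal (real_of_ereal (R z))"
  using assms unfolding proper_closed_convex_def edom_def
  by (cases "R z") auto

text \<open>A combination of graph points over \<open>y\<close> and \<open>z\<close> stays in the
  epigraph. Its real height bounds the value there and also puts the combined point in the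
  domain.\<close>

lemma convex_on_real_of_ereal:
  assumes pcc: "proper_closed_convex R"
  shows "convex_on (edom R) (\<lambda>z. real_of_ereal (R z))"
proof -
  have key: "R (u *\<^sub>R y + v *\<^sub>R z) \<le> ereal (u * real_of_ereal (R y) + v * real_of_ereal (R z))"
    if "y \<in> edom R" "z \<in> edom R" "0 \<le> u" "0 \<le> v" "u + v = 1" for y z and u v :: real
  proof -
    have "(y, real_of_ereal (R y)) \<in> ereal_epigraph R" "(z, real_of_ereal (R z)) \<in> ereal_epigraph R"
      using real_of_ereal_eq_on_edom[OF pcc that(1)] real_of_ereal_eq_on_edom[OF pcc that(2)]
      by (auto simp: ereal_epigraph_def)
    moreover have "convex (ereal_epigraph R)"
      using pcc by (simp add: proper_closed_convex_def)
    ultimately have "u *\<^sub>R (y, real_of_ereal (R y)) + v *\<^sub>R (z, real_of_ereal (R z)) \<in> ereal_epigraph R"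
      using that(3-5) unfolding convex_def by blast
    then show ?thesis by (simp add: ereal_epigraph_def)
  qed
  have "u *\<^sub>R y + v *\<^sub>R z \<in> edom R"
    if "y \<in> edom R" "z \<in> edom R" "0 \<le> u" "0 \<le> v" "u + v = 1" for y z and u v :: real
    using key[OF that] by (auto simp: edom_def)
  moreover from this key have "real_of_ereal (R (u *\<^sub>R y + v *\<^sub>R z))
       \<le> u * real_of_ereal (R y) + v * real_of_ereal (R z)"
    if "y \<in> edom R" "z \<in> edom R" "0 \<le> u" "0 \<le> v" "u + v = 1" for y z and u v :: real
    using that by (metis real_of_ereal_eq_on_edom[OF pcc] ereal_less_eq(3))
  ultimately show ?thesis
    unfolding convex_on_def convex_def by blast
qed

lemma quadratic_form_lower:
  assumes "loewner_le (\<alpha> *\<^sub>R id_blinfun) H"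
  shows "\<alpha> * (norm v)\<^sup>2 \<le> v \<bullet> blinfun_apply H v"
  using assms unfolding loewner_le_def
  by (simp add: blinfun.diff_left blinfun.scaleR_left inner_diff_right power2_norm_eq_inner)

lemma quadratic_form_upper:
  assumes "loewner_le H (\<beta> *\<^sub>R id_blinfun)"
  shows "v \<bullet> blinfun_apply H v \<le> \<beta> * (norm v)\<^sup>2"
  using assms unfolding loewner_le_def
  by (simp add: blinfun.diff_left blinfun.scaleR_left inner_diff_right power2_norm_eq_inner)

text \<open>Polarization, after rescaling both vectors to equal length.\<close>

lemma bilinear_form_lower:
  assumes "loewner_le H (\<beta> *\<^sub>R id_blinfun)"
    and nonneg: "\<And>v. 0 \<le> v \<bullet> blinfun_apply H v"
  shows "- \<beta> * norm u * norm v \<le> u \<bullet> blinfun_apply H v"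
proof (cases "u = 0 \<or> v = 0")
  case False
  define n where "n = norm u * norm v"
  have n: "n > 0" using False by (simp add: n_def)
  define a b where "a = norm v *\<^sub>R u" and "b = norm u *\<^sub>R v"
  have norms: "norm a = n" "norm b = n" by (simp_all add: a_def b_def n_def mult.commute)
  \<comment> \<open>\<open>loewner_le\<close> demands symmetry of the difference of its arguments,
    hence \<open>H\<close> itself is symmetric.\<close>
  have sym: "b \<bullet> blinfun_apply H a = a \<bullet> blinfun_apply H b"
    using assms(1) unfolding loewner_le_def
    by (simp add: blinfun.diff_left blinfun.scaleR_left inner_diff_right inner_diff_left inner_commute)
  have "0 \<le> (a + b) \<bullet> blinfun_apply H (a + b)"
    by (rule nonneg)
  moreover have "(a - b) \<bullet> blinfun_apply H (a - b) \<le> \<beta> * (norm (a - b))\<^sup>2"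
    by (rule quadratic_form_upper[OF assms(1)])
  \<comment> \<open>The form at \<open>a + b\<close> minus the form at \<open>a - b\<close> is four
    times the cross term.\<close>
  ultimately have "- (\<beta> * (norm (a - b))\<^sup>2) \<le> 4 * (a \<bullet> blinfun_apply H b)"
    using sym by (simp add: blinfun.add_right blinfun.diff_right inner_add_left inner_add_right
        inner_diff_left inner_diff_right)
  moreover have "\<beta> * (norm (a - b))\<^sup>2 \<le> \<beta> * (2 * n)\<^sup>2"
  proof -
    have "\<beta> * (norm u)\<^sup>2 \<ge> 0"
      using nonneg[of u] quadratic_form_upper[OF assms(1), of u] by linarith
    then have "\<beta> \<ge> 0" using False by (simp add: zero_le_mult_iff)
    then show ?thesis
      using norm_triangle_ineq4[of a b] norms by (intro mult_left_mono power_mono) auto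
  qed
  ultimately have "- (\<beta> * n\<^sup>2) \<le> a \<bullet> blinfun_apply H b"
    by (simp add: power2_eq_square)
  also have "a \<bullet> blinfun_apply H b = n * (u \<bullet> blinfun_apply H v)"
    by (simp add: a_def b_def n_def blinfun.scaleR_right)
  finally have "n * (- \<beta> * n) \<le> n * (u \<bullet> blinfun_apply H v)"
    by (simp add: power2_eq_square algebra_simps)
  then have "- \<beta> * n \<le> u \<bullet> blinfun_apply H v" using n by (simp only: mult_le_cancel_left_pos)
  then show ?thesis by (simp add: n_def mult.assoc)
qed (auto simp: blinfun.zero_right)

text \<open>The left side minus the term linear in \<open>d\<close> is
  \<open>d * (d / 2 - k * r)\<close>. If \<open>d\<close> exceeded the claimed bound
  \<open>e\<close>, this would exceed its value at \<open>e\<close>, which already dominates the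
  remaining right side.\<close>

lemma nonregularized_step_length:
  fixes k c r d :: real
  assumes "k \<ge> 1" "c \<ge> 0" "r \<ge> 0" "d \<ge> 0"
    and quad: "d\<^sup>2 / 2 \<le> 3 / 2 * k * r\<^sup>2 + c * r ^ 3 + k * r * d"
  shows "d \<le> 3 * k * r + c * r\<^sup>2 / 2"
proof (rule ccontr)
  define e where "e = 3 * k * r + c * r\<^sup>2 / 2"
  assume "\<not> ?thesis"
  then have "e < d" by (simp add: e_def)
  have "e \<ge> 0" using assms by (simp add: e_def)
  have e2: "e / 2 - k * r = k * r / 2 + c * r\<^sup>2 / 4" by (simp add: e_def field_simps)
  then have "e / 2 - k * r \<ge> 0" using assms by simp
  then have "e * (e / 2 - k * r) < d * (d / 2 - k * r)"
    using \<open>e < d\<close> \<open>e \<ge> 0\<close> by (intro mult_strict_mono) auto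
  also have "\<dots> \<le> 3 / 2 * k * r\<^sup>2 + c * r ^ 3"
    using quad by (simp add: algebra_simps power2_eq_square)
  \<comment> \<open>The target is the exact expansion of \<open>e * (e / 2 - k * r)\<close>;
    \<open>k \<ge> 1\<close> raises the coefficients \<open>k\<close> and 1 to
    \<open>k\<^sup>2\<close> and \<open>k\<close>, and the leftover term is a square.\<close>
  also have "\<dots> \<le> 3 / 2 * k\<^sup>2 * r\<^sup>2 + k * c * r ^ 3 + (c * r\<^sup>2)\<^sup>2 / 8"
  proof -
    have "k * r\<^sup>2 \<le> k\<^sup>2 * r\<^sup>2"
      using assms by (intro mult_right_mono) (auto simp: power2_eq_square)
    moreover have "1 * (c * r ^ 3) \<le> k * (c * r ^ 3)"
      using assms by (intro mult_right_mono) auto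
    moreover have "0 \<le> (c * r\<^sup>2)\<^sup>2" by simp
    ultimately show ?thesis by linarith
  qed
  also have "\<dots> = e * (e / 2 - k * r)"
    unfolding e2 by (simp add: e_def field_simps power2_eq_square power3_eq_cube)
  finally show False by simp
qed

lemma cube_add_le:
  fixes a b :: real
  assumes "a \<ge> 0" "b \<ge> 0"
  shows "(a + b) ^ 3 \<le> 4 * (a ^ 3 + b ^ 3)"
proof -
  have "4 * (a ^ 3 + b ^ 3) - (a + b) ^ 3 = 3 * (a + b) * (a - b)\<^sup>2"
    by (simp add: power2_eq_square power3_eq_cube algebra_simps)
  moreover have "\<dots> \<ge> 0" using assms by simp
  ultimately show ?thesis by linarith
qed

section \<open>The composite problem\<close>

locale composite =
  fixes f :: "'a::euclidean_space \<Rightarrow> real" and R :: "'a \<Rightarrow> ereal" and \<beta>2 :: real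
  assumes composite_problem: "composite_problem f R \<beta>2"
begin

text \<open>Real-valued versions, faithful only on \<open>edom R\<close>:
  \<open>real_of_ereal\<close> sends \<infinity> to 0.\<close>

abbreviation r :: "'a \<Rightarrow> real" where "r z \<equiv> real_of_ereal (R z)"
abbreviation F :: "'a \<Rightarrow> real" where "F z \<equiv> f z + r z"

lemma pcc: "proper_closed_convex R"
  and tcd: "twice_cont_diff_over f (edom R)"
  and convex_f: "convex_on (edom R) f"
  and hess_lipschitz: "\<And>u w. u \<in> edom R \<Longrightarrow> w \<in> edom R \<Longrightarrow>
    norm (hess f u - hess f w) \<le> \<beta>2 * norm (u - w)"
  using composite_problem by (auto simp: composite_problem_def)

lemma convex_dom: "convex (edom R)"
  using convex_f by (rule convex_on_imp_convex)

lemma R_eq: "z \<in> edom R \<Longrightarrow> R z = ereal (r z)"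
  using real_of_ereal_eq_on_edom[OF pcc] .

lemma objective_eq: "z \<in> edom R \<Longrightarrow> objective f R z = ereal (F z)"
  unfolding objective_def by (subst R_eq) auto

lemma mem_epigraph_iff: "z \<in> edom R \<Longrightarrow> (z, c) \<in> ereal_epigraph R \<longleftrightarrow> r z \<le> c"
  unfolding ereal_epigraph_def by (simp, subst R_eq) auto

lemma objective_notin: "z \<notin> edom R \<Longrightarrow> objective f R z = \<infinity>"
  by (simp add: edom_def objective_def)

lemma objective_le_iff: "objective f R z \<le> ereal c \<longleftrightarrow> z \<in> edom R \<and> F z \<le> c"
  by (cases "z \<in> edom R") (simp_all add: objective_eq objective_notin)

lemma convex_F: "convex_on (edom R) F"
  by (intro convex_on_add convex_f convex_on_real_of_ereal pcc)

text \<open>On a one-point domain the Lipschitz hypothesis does not force \<open>\<beta>2\<close> to be nonnegative.\<close>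

lemma beta2_cases:
  assumes "z \<in> edom R"
  obtains "\<beta>2 \<ge> 0" | "edom R = {z}"
proof (cases "edom R = {z}")
  case False
  then obtain y where y: "y \<in> edom R" "y \<noteq> z" using assms by auto
  have "0 \<le> \<beta>2 * norm (y - z)"
    using hess_lipschitz[OF y(1) assms] norm_ge_zero order_trans by blast
  then show ?thesis using y that by (simp add: zero_le_mult_iff)
qed (use that in blast)

lemma is_arg_min_objective:
  assumes "is_arg_min (objective f R) (\<lambda>_. True) z"
  shows "z \<in> edom R" and "opt_value f R = ereal (F z)" and "\<And>y. y \<in> edom R \<Longrightarrow> F z \<le> F y"
proof -
  have le: "objective f R z \<le> objective f R y" for y
    using assms by (auto simp: is_arg_min_linorder)
  obtain y where "y \<in> edom R" using pcc by (auto simp: proper_closed_convex_def)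
  then show z: "z \<in> edom R" using le[of y] by (simp add: objective_eq objective_le_iff)
  have "opt_value f R = objective f R z"
    unfolding opt_value_def by (rule antisym) (auto intro: INF_lower INF_greatest le)
  then show "opt_value f R = ereal (F z)" using z by (simp add: objective_eq)
  show "F z \<le> F y" if "y \<in> edom R" for y
    using le[of y] z that by (simp add: objective_eq)
qed

text \<open>The variational inequality for a nonsmooth \<open>R\<close>: otherwise a short move from
  \<open>z\<close> towards \<open>v\<close> would lower \<open>F\<close>.\<close>

lemma minimizer_optimality:
  assumes z: "z \<in> edom R" "\<And>y. y \<in> edom R \<Longrightarrow> F z \<le> F y" and v: "v \<in> edom R"
  shows "r z \<le> r v + (v - z) \<bullet> grad f z"
proof (rule ccontr)
  \<comment> \<open>Replacing \<open>R\<close> by its chord gives a function differentiable at 0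
    which, up to the constant \<open>r z\<close>, majorizes \<open>F\<close> on the segment with
    equality at \<open>s = 0\<close>.\<close>
  define h where "h s = f (z + s *\<^sub>R (v - z)) + s * (r v - r z)" for s
  assume "\<not> ?thesis"
  then have neg: "(v - z) \<bullet> grad f z + (r v - r z) < 0" by simp
  have "(h has_real_derivative (v - z) \<bullet> grad f z + (r v - r z)) (at 0)"
    unfolding h_def using line_derivative[OF tcd, of z 0 "v - z"] z(1)
    by (auto intro!: derivative_eq_intros)
  from DERIV_neg_dec_right[OF this neg] obtain d
    where d: "d > 0" "\<And>s. s > 0 \<Longrightarrow> s < d \<Longrightarrow> h s < h 0" by auto
  define s where "s = min 1 (d / 2)"
  have s: "0 < s" "s \<le> 1" "s < d" using d(1) by (auto simp: s_def)
  have eq: "z + s *\<^sub>R (v - z) = (1 - s) *\<^sub>R z + s *\<^sub>R v" by (simp add: algebra_simps)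
  have "z + s *\<^sub>R (v - z) \<in> edom R"
    using convex_line_mem[OF convex_dom z(1) v] s by simp
  then have "F z \<le> F (z + s *\<^sub>R (v - z))" by (rule z(2))
  moreover have "r (z + s *\<^sub>R (v - z)) \<le> (1 - s) * r z + s * r v"
    unfolding eq using convex_onD[OF convex_on_real_of_ereal[OF pcc], of s z v] s z(1) v by simp
  ultimately have "h 0 \<le> h s" by (simp add: h_def algebra_simps)
  then show False using d(2)[OF s(1,3)] by simp
qed

text \<open>The affine minorant excludes that \<open>f\<close>, arbitrary off the domain of \<open>R\<close>, tends to
  \<open>-\<infinity>\<close> along the sequence; it keeps the values of \<open>R\<close> bounded and hence the limit in the domain.\<close>

lemma objective_le_limit:
  assumes lim: "X \<longlonglongrightarrow> l" and le: "\<And>n. objective f R (X n) \<le> ereal c"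
    and minorant: "\<And>n. a + X n \<bullet> g \<le> f (X n)"
  shows "objective f R l \<le> ereal c"
proof -
  have closed: "closed (ereal_epigraph R)" using pcc by (simp add: proper_closed_convex_def)
  have X: "X n \<in> edom R" "F (X n) \<le> c" for n using le[of n] by (auto simp: objective_le_iff)
  \<comment> \<open>These heights converge without continuity of \<open>f\<close> at
    \<open>l\<close>, which is known only once \<open>l\<close> is in the domain.\<close>
  have "(X n, c - a - X n \<bullet> g) \<in> ereal_epigraph R" for n
    using X[of n] minorant[of n] by (simp add: mem_epigraph_iff)
  moreover have "(\<lambda>n. (X n, c - a - X n \<bullet> g)) \<longlonglongrightarrow> (l, c - a - l \<bullet> g)"
    by (intro tendsto_intros lim)
  ultimately have "(l, c - a - l \<bullet> g) \<in> ereal_epigraph R"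
    by (rule closed_sequentially[OF closed])
  then have l: "l \<in> edom R" by (auto simp: ereal_epigraph_def edom_def)
  \<comment> \<open>With \<open>f\<close> now continuous at \<open>l\<close>, a second passage to
    the limit gives the sharp bound.\<close>
  have "(X n, c - f (X n)) \<in> ereal_epigraph R" for n
    using X[of n] by (simp add: mem_epigraph_iff)
  moreover have "(\<lambda>n. (X n, c - f (X n))) \<longlonglongrightarrow> (l, c - f l)"
    by (intro tendsto_intros lim isCont_tendsto_compose[OF isCont_on_dom[OF tcd l]])
  ultimately have "(l, c - f l) \<in> ereal_epigraph R"
    by (rule closed_sequentially[OF closed])
  then show ?thesis using l by (simp add: mem_epigraph_iff objective_le_iff)
qed

section \<open>Inequalities for one call of an oracle\<close>

lemma quadratic_taylor:
  assumes "y \<in> edom R" "z \<in> edom R"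
  shows "\<bar>f z - (f y + (z - y) \<bullet> grad f y + (z - y) \<bullet> blinfun_apply (hess f y) (z - y) / 2)\<bar>
     \<le> \<beta>2 / 6 * norm (z - y) ^ 3"
  using cubic_taylor[OF tcd convex_dom assms hess_lipschitz] .

lemma prox_model_eq:
  "w \<in> edom R \<Longrightarrow> prox_model f R y 1 w =
     ereal ((w - y) \<bullet> grad f y + (w - y) \<bullet> blinfun_apply (hess f y) (w - y) / 2 + r w)"
  unfolding prox_model_def by (subst R_eq) auto

lemma WPNO_step:
  assumes "WPNO f R C \<A>" and y: "y \<in> edom R" and z: "z = minimizer f R" "z \<in> edom R"
    and v: "v = \<A> y 1"
  shows "C \<ge> 0" and "v \<in> edom R"
    and "(v - y) \<bullet> grad f y + (v - y) \<bullet> blinfun_apply (hess f y) (v - y) / 2 + r v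
      \<le> (z - y) \<bullet> grad f y + (z - y) \<bullet> blinfun_apply (hess f y) (z - y) / 2 + r z
        + C * norm (y - z) ^ 3"
proof -
  have "\<forall>\<eta>\<ge>0. \<A> y \<eta> \<in> edom R \<and> prox_model f R y \<eta> (\<A> y \<eta>)
      \<le> prox_model f R y \<eta> z + ereal (\<eta>\<^sup>2 * C * norm (y - z) ^ 3)"
    using assms(1) y unfolding WPNO_def z by blast
  from this[rule_format, of 1] have *: "v \<in> edom R"
    "prox_model f R y 1 v \<le> prox_model f R y 1 z + ereal (C * norm (y - z) ^ 3)"
    by (simp_all add: v)
  show "C \<ge> 0" using assms(1) by (simp add: WPNO_def)
  show "v \<in> edom R" by (rule *)
  show "(v - y) \<bullet> grad f y + (v - y) \<bullet> blinfun_apply (hess f y) (v - y) / 2 + r v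
      \<le> (z - y) \<bullet> grad f y + (z - y) \<bullet> blinfun_apply (hess f y) (z - y) / 2 + r z
        + C * norm (y - z) ^ 3"
    using * z(2) by (simp add: prox_model_eq)
qed

text \<open>At the oracle output the cubic regularizer pays for the Taylor remainder. At the
  minimizer the regularizer and the remainder each cost \<open>\<beta>2 / 6\<close>, which together
  make \<open>\<beta>2 / 3\<close>.\<close>

lemma WRPNO_gap:
  assumes "WRPNO f R \<beta>2 C \<A>" and y: "y \<in> edom R" and xs: "minimizer f R \<in> edom R"
  shows "F (\<A> y 1) - F (minimizer f R) \<le> (C + \<beta>2 / 3) * norm (y - minimizer f R) ^ 3"
proof -
  define v where "v = \<A> y 1"
  define z where "z = minimizer f R"
  have "\<forall>\<eta>\<ge>0. \<A> y \<eta> \<in> edom R \<and> reg_prox_model f R \<beta>2 y \<eta> (\<A> y \<eta>)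
      \<le> reg_prox_model f R \<beta>2 y \<eta> z + ereal (\<eta>\<^sup>2 * C * norm (y - z) ^ 3)"
    using assms(1) y unfolding WRPNO_def z_def by blast
  from this[rule_format, of 1] have v: "v \<in> edom R" and
    "reg_prox_model f R \<beta>2 y 1 v \<le> reg_prox_model f R \<beta>2 y 1 z + ereal (C * norm (y - z) ^ 3)"
    by (simp_all add: v_def)
  then have "(v - y) \<bullet> grad f y + (v - y) \<bullet> blinfun_apply (hess f y) (v - y) / 2 + r v
      + \<beta>2 / 6 * norm (v - y) ^ 3
    \<le> (z - y) \<bullet> grad f y + (z - y) \<bullet> blinfun_apply (hess f y) (z - y) / 2 + r z
      + \<beta>2 / 6 * norm (z - y) ^ 3 + C * norm (z - y) ^ 3"
    using xs by (simp add: reg_prox_model_def prox_model_eq z_def norm_minus_commute)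
  moreover note quadratic_taylor[OF y v, THEN abs_le_D1]
  moreover have "z \<in> edom R" using xs by (simp add: z_def)
  note quadratic_taylor[OF y this, THEN abs_le_D2]
  ultimately show ?thesis
    by (simp add: norm_minus_commute distrib_right flip: z_def v_def)
qed

end

section \<open>Strong convexity on the initial level set\<close>

locale strongly_convex_level = composite +
  fixes x1 :: 'a and \<alpha> \<beta> :: real
  assumes assumption_A: "assumption_A f R x1 \<alpha> \<beta>"
begin

definition L :: "'a set" where "L = {z. objective f R z \<le> objective f R x1}"

lemma alpha_pos: "\<alpha> > 0" and beta_pos: "\<beta> > 0" and x1_dom: "x1 \<in> edom R"
  using assumption_A by (auto simp: assumption_A_def)

lemma L_iff: "z \<in> L \<longleftrightarrow> z \<in> edom R \<and> F z \<le> F x1"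
  unfolding L_def by (simp add: objective_eq[OF x1_dom] objective_le_iff)

lemma L_subset: "L \<subseteq> edom R"
  by (auto simp: L_iff)

lemma convex_L: "convex L"
proof (rule convexI)
  fix y z and u v :: real
  assume *: "y \<in> L" "z \<in> L" "0 \<le> u" "0 \<le> v" "u + v = 1"
  have "F (u *\<^sub>R y + v *\<^sub>R z) \<le> u * F y + v * F z"
    using convex_F * unfolding convex_on_def L_iff by blast
  also have "\<dots> \<le> u * F x1 + v * F x1"
    using * by (intro add_mono[of "u * F y"] mult_left_mono) (auto simp: L_iff)
  also have "\<dots> = F x1" using *(5) by (metis distrib_right mult_1)
  finally show "u *\<^sub>R y + v *\<^sub>R z \<in> L"
    using * convex_dom unfolding L_iff convex_def by blast
qed

lemma hess_upper: "z \<in> L \<Longrightarrow> loewner_le (hess f z) (\<beta> *\<^sub>R id_blinfun)"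
  and hess_lower: "z \<in> L \<Longrightarrow> loewner_le (\<alpha> *\<^sub>R id_blinfun) (hess f z)"
  using assumption_A by (auto simp: assumption_A_def L_def)

text \<open>Both Hessian bounds are tested on a unit vector at \<open>x1\<close>. This provides the
  ratio \<open>\<beta> / \<alpha> \<ge> 1\<close> required for the step-length estimate.\<close>

lemma alpha_le_beta: "\<alpha> \<le> \<beta>"
proof -
  obtain b :: 'a where b: "b \<in> Basis" using nonempty_Basis by blast
  have "x1 \<in> L" by (simp add: L_def)
  from quadratic_form_lower[OF hess_lower[OF this], of b] quadratic_form_upper[OF hess_upper[OF this], of b]
  show ?thesis using b by simp
qed

lemma gradient_inequality:
  assumes "y \<in> L" "z \<in> L"
  shows "f y + (z - y) \<bullet> grad f y + \<alpha> / 2 * (norm (z - y))\<^sup>2 \<le> f z"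
  using taylor_lower[OF tcd convex_L L_subset assms, of "\<alpha> * (norm (z - y))\<^sup>2" 0]
    quadratic_form_lower[OF hess_lower[OF convex_line_mem[OF convex_L assms]]]
  by simp

text \<open>The gradient inequalities from \<open>w\<close> to both endpoints are averaged with
  weights \<open>1 - s\<close> and \<open>s\<close>: the linear terms cancel and the quadratic ones
  add up to \<open>s * (1 - s)\<close>. Convexity of \<open>R\<close> supplies the rest.\<close>

lemma strong_convexity:
  assumes yz: "y \<in> L" "z \<in> L" and s: "0 \<le> s" "s \<le> 1"
  shows "F (y + s *\<^sub>R (z - y)) \<le> (1 - s) * F y + s * F z - \<alpha> / 2 * (s * (1 - s)) * (norm (z - y))\<^sup>2"
proof -
  define w where "w = y + s *\<^sub>R (z - y)"
  have w: "w \<in> L" unfolding w_def using convex_line_mem[OF convex_L yz s] .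
  have dy: "y - w = (- s) *\<^sub>R (z - y)" and dz: "z - w = (1 - s) *\<^sub>R (z - y)"
    by (simp_all add: w_def algebra_simps)
  define n where "n = \<alpha> / 2 * (norm (z - y))\<^sup>2"
  define p where "p = (z - y) \<bullet> grad f w"
  have "(1 - s) * (f w - s * p + s\<^sup>2 * n) \<le> (1 - s) * f y"
    using gradient_inequality[OF w yz(1)] s unfolding dy
    by (intro mult_left_mono) (simp_all add: n_def p_def power_mult_distrib mult_ac)
  moreover have "s * (f w + (1 - s) * p + (1 - s)\<^sup>2 * n) \<le> s * f z"
    using gradient_inequality[OF w yz(2)] s unfolding dz
    by (intro mult_left_mono) (simp_all add: n_def p_def power_mult_distrib mult_ac)
  ultimately have "(1 - s) * (f w - s * p + s\<^sup>2 * n) + s * (f w + (1 - s) * p + (1 - s)\<^sup>2 * n)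
      \<le> (1 - s) * f y + s * f z"
    by (rule add_mono)
  moreover have "(1 - s) * (f w - s * p + s\<^sup>2 * n) + s * (f w + (1 - s) * p + (1 - s)\<^sup>2 * n)
      = f w + s * (1 - s) * n"
    by (simp add: power2_eq_square algebra_simps)
  moreover have "w = (1 - s) *\<^sub>R y + s *\<^sub>R z" by (simp add: w_def algebra_simps)
  then have "r w \<le> (1 - s) * r y + s * r z"
    using convex_onD[OF convex_on_real_of_ereal[OF pcc], of s y z] s yz by (simp add: L_iff)
  moreover have "\<alpha> / 2 * (s * (1 - s)) * (norm (z - y))\<^sup>2 = s * (1 - s) * n" by (simp add: n_def)
  ultimately show ?thesis
    unfolding w_def[symmetric] by (simp only: distrib_left)
qed

text \<open>Strong convexity makes a minimizing sequence in \<open>L\<close> Cauchy, and closedness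
  of the epigraph of \<open>R\<close> puts its limit at the optimal level.\<close>

lemma exists_minimizer: "\<exists>z. is_arg_min (objective f R) (\<lambda>_. True) z"
proof -
  obtain b where b: "\<And>z. ereal b \<le> objective f R z"
    using composite_problem by (auto simp: composite_problem_def)
  have "ereal b \<le> opt_value f R" unfolding opt_value_def by (intro INF_greatest b)
  moreover have opt_le: "opt_value f R \<le> objective f R z" for z
    unfolding opt_value_def by (rule INF_lower) simp
  note opt_le[of x1]
  ultimately obtain m where m: "opt_value f R = ereal m"
    by (cases "opt_value f R") (auto simp: objective_eq[OF x1_dom])
  have m_le: "m \<le> F z" if "z \<in> edom R" for z
    using opt_le[of z] by (simp add: m objective_eq[OF that])
  have "\<exists>z. z \<in> L \<and> F z \<le> m + 1 / real (Suc n)" for n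
  proof -
    have "opt_value f R < ereal (m + 1 / real (Suc n))" by (simp add: m)
    then obtain z where "objective f R z < ereal (m + 1 / real (Suc n))"
      unfolding opt_value_def INF_less_iff by blast
    then have z: "z \<in> edom R" "F z \<le> m + 1 / real (Suc n)"
      by (auto simp: objective_le_iff dest!: less_imp_le)
    \<comment> \<open>A near-optimal point outside \<open>L\<close> has a larger value than
      \<open>x1\<close>, so \<open>x1\<close> serves instead.\<close>
    then show ?thesis using x1_dom by (cases "F z \<le> F x1") (force simp: L_iff)+
  qed
  then obtain X where X: "\<And>n. X n \<in> L" "\<And>n. F (X n) \<le> m + 1 / real (Suc n)" by metis
  have dist: "(dist (X i) (X j))\<^sup>2 \<le> 8 / \<alpha> * (1 / real (Suc N))" if "N \<le> i" "N \<le> j" for i j N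
  proof -
    have N: "F (X k) \<le> m + 1 / real (Suc N)" if "N \<le> k" for k
      using X(2)[of k] that by (simp add: frac_le order_trans)
    \<comment> \<open>The midpoint cannot go below \<open>m\<close>, while strong convexity at
      \<open>s = 1/2\<close> puts it \<open>\<alpha> / 8\<close> times the squared distance below
      the mean of two values close to \<open>m\<close>.\<close>
    have "X i + (1/2) *\<^sub>R (X j - X i) \<in> edom R"
      using convex_line_mem[OF convex_L X(1) X(1), of "1/2"] L_subset by auto
    then have "m \<le> F (X i + (1/2) *\<^sub>R (X j - X i))" by (rule m_le)
    also have "\<dots> \<le> 1/2 * F (X i) + 1/2 * F (X j) - \<alpha> / 8 * (norm (X j - X i))\<^sup>2"
      using strong_convexity[OF X(1) X(1), of "1/2"] by simp
    finally have "\<alpha> / 8 * (norm (X j - X i))\<^sup>2 \<le> 1 / real (Suc N)"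
      using N[OF that(1)] N[OF that(2)] by argo
    then have "8 / \<alpha> * (\<alpha> / 8 * (norm (X j - X i))\<^sup>2) \<le> 8 / \<alpha> * (1 / real (Suc N))"
      using alpha_pos by (intro mult_left_mono) auto
    then show ?thesis
      using alpha_pos by (simp add: dist_norm norm_minus_commute del: of_nat_Suc)
  qed
  have "Cauchy X"
  proof (rule metric_CauchyI)
    fix e :: real assume "e > 0"
    then have "0 < e\<^sup>2 * \<alpha> / 8" using alpha_pos by simp
    then obtain N where "1 / real (Suc N) < e\<^sup>2 * \<alpha> / 8" by (rule nat_approx_posE)
    then have "8 / \<alpha> * (1 / real (Suc N)) < 8 / \<alpha> * (e\<^sup>2 * \<alpha> / 8)"
      using alpha_pos by (intro mult_strict_left_mono) auto
    then have N: "8 / \<alpha> * (1 / real (Suc N)) < e\<^sup>2"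
      using alpha_pos by (simp del: of_nat_Suc)
    have "dist (X i) (X j) < e" if "N \<le> i" "N \<le> j" for i j
      using order.strict_trans1[OF dist[OF that] N] \<open>e > 0\<close>
      by (meson less_imp_le power_less_imp_less_base)
    then show "\<exists>N. \<forall>i\<ge>N. \<forall>j\<ge>N. dist (X i) (X j) < e" by blast
  qed
  then obtain l where l: "X \<longlonglongrightarrow> l" using Cauchy_convergent_iff convergent_def by blast
  have "objective f R l \<le> ereal (m + 1 / real (Suc k))" for k
  proof (rule objective_le_limit)
    \<comment> \<open>Passing to the tail makes every term satisfy the level for
      \<open>k\<close>.\<close>
    show "(\<lambda>n. X (n + k)) \<longlonglongrightarrow> l" using l by (rule LIMSEQ_ignore_initial_segment)
    show "objective f R (X (n + k)) \<le> ereal (m + 1 / real (Suc k))" for n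
    proof -
      have "1 / real (Suc (n + k)) \<le> 1 / real (Suc k)" by (simp add: frac_le)
      then show ?thesis using X(1)[of "n + k"] X(2)[of "n + k"] by (simp add: objective_le_iff L_iff)
    qed
    \<comment> \<open>The affine minorant is the tangent of \<open>f\<close> at \<open>x1\<close>,
      valid on \<open>L\<close> by convexity there.\<close>
    show "(f x1 - x1 \<bullet> grad f x1) + X (n + k) \<bullet> grad f x1 \<le> f (X (n + k))" for n
    proof -
      have "0 \<le> \<alpha> / 2 * (norm (X (n + k) - x1))\<^sup>2" using alpha_pos by simp
      then show ?thesis
        using gradient_inequality[OF _ X(1), of x1 "n + k"] by (simp add: L_def inner_diff_left)
    qed
  qed
  then have l: "l \<in> edom R" "\<And>k. F l \<le> m + 1 / real (Suc k)" by (auto simp: objective_le_iff)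
  have "F l \<le> m"
  proof (rule ccontr)
    assume "\<not> ?thesis"
    then have "0 < F l - m" by simp
    then obtain k where "1 / real (Suc k) < F l - m" by (rule nat_approx_posE)
    then show False using l(2)[of k] by simp
  qed
  then have "objective f R l \<le> opt_value f R" by (simp add: m objective_le_iff l(1))
  then have "objective f R l \<le> objective f R z" for z using opt_le by (rule order_trans)
  then show ?thesis by (auto simp: is_arg_min_linorder)
qed

lemma is_arg_min_minimizer: "is_arg_min (objective f R) (\<lambda>_. True) (minimizer f R)"
  unfolding minimizer_def arg_min_def using exists_minimizer by (rule someI_ex)

abbreviation xs :: 'a where "xs \<equiv> minimizer f R"

lemmas xs_min = is_arg_min_objective[OF is_arg_min_minimizer]

lemma xs_L: "xs \<in> L"
  using xs_min x1_dom by (simp add: L_iff)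

text \<open>Minimality is compared with strong convexity at
  \<open>xs + s *\<^sub>R (z - xs)\<close>; after division by \<open>s\<close>, letting
  \<open>s\<close> tend to 0 recovers the full constant. The limit is taken in
  \<open>t = 1 - s\<close>.\<close>

lemma quadratic_growth:
  assumes z: "z \<in> L"
  shows "(norm (z - xs))\<^sup>2 \<le> 2 / \<alpha> * (F z - F xs)"
proof -
  define n where "n = \<alpha> / 2 * (norm (z - xs))\<^sup>2"
  have "n * t \<le> F z - F xs" if "0 \<le> t" "t < 1" for t
  proof -
    define s where "s = 1 - t"
    have s: "0 < s" "s \<le> 1" using that by (auto simp: s_def)
    have "F xs \<le> F (xs + s *\<^sub>R (z - xs))"
      using convex_line_mem[OF convex_L xs_L z, of s] s L_subset by (intro xs_min(3)) auto
    also have "\<dots> \<le> (1 - s) * F xs + s * F z - s * (1 - s) * n"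
      using strong_convexity[OF xs_L z, of s] s by (simp add: n_def mult_ac)
    finally have "s * (n * (1 - s)) \<le> s * (F z - F xs)" by (simp add: algebra_simps)
    then show ?thesis using s by (simp add: s_def)
  qed
  moreover have "((\<lambda>t. n * t) \<longlongrightarrow> n * 1) (at_left 1)" by (intro tendsto_intros)
  moreover have "eventually (\<lambda>t. 0 \<le> t \<and> t < 1) (at_left (1::real))"
    by (rule eventually_at_leftI[of 0]) auto
  ultimately have "n * 1 \<le> F z - F xs"
    by (intro tendsto_upperbound[OF \<open>((\<lambda>t. n * t) \<longlongrightarrow> n * 1) (at_left 1)\<close>])
       (auto elim: eventually_mono)
  then show ?thesis using alpha_pos by (simp add: n_def field_simps)
qed

section \<open>Step length and gap for the non-regularized oracle\<close>

text \<open>The mean value theorem for the gradient tested against \<open>u\<close> leaves a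
  bilinear form of the Hessian at a point of \<open>L\<close>, where polarization applies.\<close>

lemma gradient_variation:
  assumes y: "y \<in> L"
  shows "- \<beta> * norm u * norm (y - xs) \<le> u \<bullet> grad f y - u \<bullet> grad f xs"
proof -
  have mem: "xs + s *\<^sub>R (y - xs) \<in> L" if "0 \<le> s" "s \<le> 1" for s
    using convex_line_mem[OF convex_L xs_L y that] .
  have "\<exists>s>0. s < 1 \<and> u \<bullet> grad f (xs + 1 *\<^sub>R (y - xs)) - u \<bullet> grad f (xs + 0 *\<^sub>R (y - xs))
      = (1 - 0) * (u \<bullet> blinfun_apply (hess f (xs + s *\<^sub>R (y - xs))) (y - xs))"
    by (rule MVT2[OF zero_less_one line_derivative_grad[OF tcd]]) (use mem L_subset in blast)
  then obtain s where s: "0 < s" "s < 1" and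
    eq: "u \<bullet> grad f y - u \<bullet> grad f xs = u \<bullet> blinfun_apply (hess f (xs + s *\<^sub>R (y - xs))) (y - xs)"
    by auto
  have w: "xs + s *\<^sub>R (y - xs) \<in> L" using mem s by simp
  show ?thesis unfolding eq
  proof (rule bilinear_form_lower[OF hess_upper[OF w]])
    show "0 \<le> v \<bullet> blinfun_apply (hess f (xs + s *\<^sub>R (y - xs))) v" for v
      using quadratic_form_lower[OF hess_lower[OF w], of v] alpha_pos
      by (meson less_imp_le mult_nonneg_nonneg order_trans zero_le_power2)
  qed
qed

lemma WPNO_step_length:
  assumes "WPNO f R C \<A>" and y: "y \<in> L"
  shows "norm (\<A> y 1 - y) \<le> 3 * (\<beta> / \<alpha>) * norm (y - xs) + C / \<alpha> * (norm (y - xs))\<^sup>2 / 2"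
proof -
  define v where "v = \<A> y 1"
  define \<rho> d where "\<rho> = norm (y - xs)" and "d = norm (v - y)"
  have yS: "y \<in> edom R" using y L_subset by blast
  note C = WPNO_step(1)[OF assms(1) yS refl xs_min(1) v_def]
    and v = WPNO_step(2)[OF assms(1) yS refl xs_min(1) v_def]
    and model = WPNO_step(3)[OF assms(1) yS refl xs_min(1) v_def, folded \<rho>_def]
  have "r xs \<le> r v + (v - xs) \<bullet> grad f xs"
    by (rule minimizer_optimality[OF xs_min(1,3) v])
  \<comment> \<open>The output \<open>v\<close> may leave \<open>L\<close>, so gradients are
    compared only between \<open>xs\<close> and \<open>y\<close>; \<open>v\<close> enters through
    the direction alone.\<close>
  moreover have "- (\<beta> * (d + \<rho>) * \<rho>) \<le> (v - xs) \<bullet> grad f y - (v - xs) \<bullet> grad f xs"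
  proof -
    have "norm (v - xs) \<le> d + \<rho>"
      using norm_triangle_ineq[of "v - y" "y - xs"] by (simp add: d_def \<rho>_def)
    then have "\<beta> * norm (v - xs) * \<rho> \<le> \<beta> * (d + \<rho>) * \<rho>"
      using beta_pos by (intro mult_right_mono mult_left_mono) (auto simp: \<rho>_def)
    then show ?thesis using gradient_variation[OF y, of "v - xs"] by (simp add: \<rho>_def)
  qed
  moreover have "\<alpha> * d\<^sup>2 \<le> (v - y) \<bullet> blinfun_apply (hess f y) (v - y)"
    unfolding d_def by (rule quadratic_form_lower[OF hess_lower[OF y]])
  moreover have "(xs - y) \<bullet> blinfun_apply (hess f y) (xs - y) \<le> \<beta> * \<rho>\<^sup>2"
    unfolding \<rho>_def norm_minus_commute[of y] by (rule quadratic_form_upper[OF hess_upper[OF y]])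
  \<comment> \<open>Adding the model inequality and the optimality of \<open>xs\<close> cancels
    \<open>r v\<close> and \<open>r xs\<close>, and the linear terms reduce to the gradient
    variation just bounded.\<close>
  ultimately have "\<alpha> * d\<^sup>2 / 2 \<le> \<beta> * \<rho>\<^sup>2 / 2 + C * \<rho> ^ 3 + \<beta> * (d + \<rho>) * \<rho>"
    using model inner_diff_left[of "v - y" "xs - y" "grad f y"] by simp
  also have "\<dots> = \<alpha> * (3 / 2 * (\<beta> / \<alpha>) * \<rho>\<^sup>2 + C / \<alpha> * \<rho> ^ 3 + \<beta> / \<alpha> * \<rho> * d)"
    using alpha_pos by (simp add: field_simps power2_eq_square)
  finally have "\<alpha> * (d\<^sup>2 / 2) \<le> \<dots>" by simp
  then have "d\<^sup>2 / 2 \<le> 3 / 2 * (\<beta> / \<alpha>) * \<rho>\<^sup>2 + C / \<alpha> * \<rho> ^ 3 + \<beta> / \<alpha> * \<rho> * d"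
    using alpha_pos by (simp only: mult_le_cancel_left_pos)
  then have "d \<le> 3 * (\<beta> / \<alpha>) * \<rho> + C / \<alpha> * \<rho>\<^sup>2 / 2"
    using alpha_pos alpha_le_beta C
    by (intro nonregularized_step_length) (auto simp: \<rho>_def d_def)
  then show ?thesis by (simp add: d_def \<rho>_def v_def)
qed

text \<open>With no regularizer to absorb it, the Taylor remainder at the output is controlled by
  the step length, whose two terms cube to multiples of the third and sixth powers of the
  distance.\<close>

lemma WPNO_gap:
  assumes wpno: "WPNO f R C \<A>" and y: "y \<in> L" and "\<beta>2 \<ge> 0"
  shows "F (\<A> y 1) - F xs
    \<le> (5 * \<beta>2 / 6 + C + 1000 * \<beta>2 * \<beta> ^ 3 / (3 * \<alpha> ^ 3)) * norm (y - xs) ^ 3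
      + 8 / 3 * \<beta>2 * C ^ 3 / \<alpha> ^ 3 * norm (y - xs) ^ 6"
proof -
  define v where "v = \<A> y 1"
  define \<rho> d k c where "\<rho> = norm (y - xs)" and "d = norm (v - y)"
    and "k = \<beta> / \<alpha>" and "c = C / \<alpha>"
  have yS: "y \<in> edom R" using y L_subset by blast
  note C = WPNO_step(1)[OF wpno yS refl xs_min(1) v_def]
    and v = WPNO_step(2)[OF wpno yS refl xs_min(1) v_def]
    and model = WPNO_step(3)[OF wpno yS refl xs_min(1) v_def, folded \<rho>_def]
  have pos: "\<rho> \<ge> 0" "d \<ge> 0" "k \<ge> 0" "c \<ge> 0"
    using alpha_pos beta_pos C by (auto simp: \<rho>_def d_def k_def c_def)
  note quadratic_taylor[OF yS v, THEN abs_le_D1, folded d_def]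
  moreover note quadratic_taylor[OF yS xs_min(1), THEN abs_le_D2,
      unfolded norm_minus_commute[of _ y], folded \<rho>_def]
  ultimately have "F v - F xs \<le> C * \<rho> ^ 3 + \<beta>2 / 6 * \<rho> ^ 3 + \<beta>2 / 6 * d ^ 3"
    using model by simp
  moreover have "d ^ 3 \<le> 108 * (k ^ 3 * \<rho> ^ 3) + c ^ 3 * \<rho> ^ 6 / 2"
  proof -
    have "d ^ 3 \<le> (3 * k * \<rho> + c * \<rho>\<^sup>2 / 2) ^ 3"
      using WPNO_step_length[OF wpno y] pos
      by (intro power_mono) (simp_all add: d_def \<rho>_def v_def k_def c_def)
    also have "\<dots> \<le> 4 * ((3 * k * \<rho>) ^ 3 + (c * \<rho>\<^sup>2 / 2) ^ 3)"
      using pos by (intro cube_add_le) auto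
    also have "\<dots> = 108 * (k ^ 3 * \<rho> ^ 3) + c ^ 3 * \<rho> ^ 6 / 2"
      by (simp add: power_mult_distrib power_divide flip: power_mult)
    finally show ?thesis .
  qed
  then have "\<beta>2 / 6 * d ^ 3 \<le> \<beta>2 / 6 * (108 * (k ^ 3 * \<rho> ^ 3) + c ^ 3 * \<rho> ^ 6 / 2)"
    using \<open>\<beta>2 \<ge> 0\<close> by (intro mult_left_mono) auto
  moreover have "0 \<le> \<beta>2 * \<rho> ^ 3" "0 \<le> \<beta>2 * (k ^ 3 * \<rho> ^ 3)" "0 \<le> \<beta>2 * (c ^ 3 * \<rho> ^ 6)"
    using pos \<open>\<beta>2 \<ge> 0\<close> by auto
  \<comment> \<open>The coefficients obtained, 1/6, 108/6 = 18 and 1/12, are relaxed to the stated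
    5/6, 1000/3 and 8/3.\<close>
  ultimately have "F v - F xs \<le> C * \<rho> ^ 3 + 5 / 6 * (\<beta>2 * \<rho> ^ 3)
      + 1000 / 3 * (\<beta>2 * (k ^ 3 * \<rho> ^ 3)) + 8 / 3 * (\<beta>2 * (c ^ 3 * \<rho> ^ 6))"
    by (simp add: distrib_left mult_ac)
  also have "\<dots> = (5 * \<beta>2 / 6 + C + 1000 * \<beta>2 * \<beta> ^ 3 / (3 * \<alpha> ^ 3)) * \<rho> ^ 3
      + 8 / 3 * \<beta>2 * C ^ 3 / \<alpha> ^ 3 * \<rho> ^ 6"
    by (simp add: k_def c_def power_divide distrib_right)
  finally show ?thesis by (simp add: v_def \<rho>_def)
qed

end

section \<open>Convergence of the iterates\<close>

lemma cube_le_of_square_le: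
  fixes \<rho> G \<alpha> :: real
  assumes "\<alpha> > 0" "\<rho> \<ge> 0" "\<rho>\<^sup>2 \<le> 2 / \<alpha> * G"
  shows "\<rho> ^ 3 \<le> 2 * sqrt 2 / \<alpha> powr (3/2) * G powr (3/2)"
proof -
  have "0 \<le> 2 / \<alpha> * G" using assms(3) zero_le_power2 order_trans by blast
  then have G: "G \<ge> 0" using assms(1) by (simp add: zero_le_mult_iff zero_le_divide_iff)
  have "\<rho> ^ 3 = (\<rho>\<^sup>2) powr (3/2)"
    using assms(2) by (cases "\<rho> = 0") (simp_all add: powr_powr flip: powr_numeral)
  also have "\<dots> \<le> (2 / \<alpha> * G) powr (3/2)"
    using assms by (intro powr_mono2) auto
  also have "\<dots> = 2 powr (3/2) / \<alpha> powr (3/2) * G powr (3/2)"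
    using assms(1) G by (simp add: powr_mult powr_divide)
  also have "(2::real) powr (3/2) = 2 * sqrt 2"
    using powr_add[of "2::real" 1 "1/2"] by (simp add: powr_half_sqrt)
  finally show ?thesis .
qed

context composite
begin

text \<open>A step is accepted only if it lowers the objective, so the iterates stay where the
  Hessian bounds of Assumption A hold.\<close>

lemma newton_iterates_level:
  assumes iter: "newton_iterates f R \<A> x" and dom: "\<And>y. y \<in> edom R \<Longrightarrow> \<A> y 1 \<in> edom R" and "t \<ge> 1"
  shows "x t \<in> edom R \<and> F (x t) \<le> F (x 1)"
  using \<open>t \<ge> 1\<close>
proof (induction t rule: dec_induct)
  case base
  then show ?case using iter by (simp add: newton_iterates_def)
next
  case (step n)
  then have "x (Suc n) = (if objective f R (\<A> (x n) 1) < objective f R (x n) then \<A> (x n) 1 else x n)"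
    using iter by (simp add: newton_iterates_def)
  then show ?case using step dom[of "x n"] by (auto simp: objective_eq)
qed

text \<open>A rejected output is no better than the current point, so a bound on the output carries
  over to the next iterate in either case.\<close>

lemma newton_iterates_decrease:
  assumes iter: "newton_iterates f R \<A> x" and dom: "\<And>y. y \<in> edom R \<Longrightarrow> \<A> y 1 \<in> edom R" and "t \<ge> 1"
  shows "F (x (Suc t)) \<le> F (\<A> (x t) 1)"
proof -
  have "x (Suc t) = (if objective f R (\<A> (x t) 1) < objective f R (x t) then \<A> (x t) 1 else x t)"
    using iter \<open>t \<ge> 1\<close> by (simp add: newton_iterates_def)
  then show ?thesis
    using newton_iterates_level[OF assms] dom[of "x t"] by (auto simp: objective_eq)
qed

lemma gap_eq:
  assumes "is_arg_min (objective f R) (\<lambda>_. True) z" "y \<in> edom R"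
  shows "gap f R y = ereal (F y - F z)"
  using is_arg_min_objective[OF assms(1)] assms(2) by (simp add: gap_def objective_eq)

text \<open>Growth is asked for on the initial level set only, so that both assumptions can supply
  it.\<close>

lemma WRPNO_iterates_gap:
  assumes iter: "newton_iterates f R \<A> x" and wrpno: "WRPNO f R \<beta>2 C \<A>" and "\<alpha> > 0"
    and min: "is_arg_min (objective f R) (\<lambda>_. True) (minimizer f R)"
    and growth: "\<And>y. y \<in> edom R \<Longrightarrow> F y \<le> F (x 1) \<Longrightarrow>
      (norm (y - minimizer f R))\<^sup>2 \<le> 2 / \<alpha> * (F y - F (minimizer f R))"
    and "t \<ge> 1"
  shows "gap f R (x (Suc t)) \<le> ereal (2 * sqrt 2 / \<alpha> powr (3/2) * (C + \<beta>2 / 3)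
    * real_of_ereal (gap f R (x t)) powr (3/2))"
proof -
  let ?z = "minimizer f R"
  have dom: "\<A> y 1 \<in> edom R" if "y \<in> edom R" for y
    using wrpno that by (simp add: WRPNO_def)
  have C: "C \<ge> 0" using wrpno by (simp add: WRPNO_def)
  note xt = newton_iterates_level[OF iter dom]
  have y: "x t \<in> edom R" "F (x t) \<le> F (x 1)" and y': "x (Suc t) \<in> edom R"
    using xt[of t] xt[of "Suc t"] \<open>t \<ge> 1\<close> by auto
  note z = is_arg_min_objective[OF min]
  let ?G = "F (x t) - F ?z"
  have "F (x (Suc t)) - F ?z \<le> 2 * sqrt 2 / \<alpha> powr (3/2) * (C + \<beta>2 / 3) * ?G powr (3/2)"
  proof (rule beta2_cases[OF z(1)])
    assume "\<beta>2 \<ge> 0"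
    have "F (x (Suc t)) - F ?z \<le> (C + \<beta>2 / 3) * norm (x t - ?z) ^ 3"
      using newton_iterates_decrease[OF iter dom \<open>t \<ge> 1\<close>] WRPNO_gap[OF wrpno y(1) z(1)] by linarith
    also have "\<dots> \<le> (C + \<beta>2 / 3) * (2 * sqrt 2 / \<alpha> powr (3/2) * ?G powr (3/2))"
      using \<open>\<beta>2 \<ge> 0\<close> C \<open>\<alpha> > 0\<close> growth[OF y] by (intro mult_left_mono cube_le_of_square_le) auto
    finally show ?thesis by (simp add: mult_ac)
  next
    \<comment> \<open>Here \<open>C + \<beta>2 / 3\<close> may be negative, but both gaps vanish and
      \<open>0 powr (3/2)\<close> is 0.\<close>
    assume "edom R = {?z}"
    then have "x t = ?z" "x (Suc t) = ?z" using y y' by auto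
    then show ?thesis by simp
  qed
  then show ?thesis by (simp add: gap_eq[OF min] y y')
qed

end

lemma (in strongly_convex_level) WPNO_iterates_gap:
  assumes iter: "newton_iterates f R \<A> x" and wpno: "WPNO f R C \<A>" and "x 1 = x1" and "t \<ge> 1"
  shows "gap f R (x (Suc t)) \<le>
    ereal (2 * sqrt 2 / \<alpha> powr (3/2) * (5 * \<beta>2 / 6 + C + 1000 * \<beta>2 * \<beta> ^ 3 / (3 * \<alpha> ^ 3))
             * real_of_ereal (gap f R (x t)) powr (3/2)
           + 64 * \<beta>2 * C ^ 3 / (3 * \<alpha> ^ 6) * real_of_ereal (gap f R (x t)) ^ 3)"
proof -
  have dom: "\<A> y 1 \<in> edom R" if "y \<in> edom R" for y
    using wpno that by (simp add: WPNO_def)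
  have C: "C \<ge> 0" using wpno by (simp add: WPNO_def)
  note xt = newton_iterates_level[OF iter dom]
  have y: "x t \<in> L" and yS: "x t \<in> edom R" and y': "x (Suc t) \<in> edom R"
    using xt[of t] xt[of "Suc t"] \<open>t \<ge> 1\<close> \<open>x 1 = x1\<close> by (auto simp: L_iff)
  define G where "G = F (x t) - F xs"
  define K where "K = 5 * \<beta>2 / 6 + C + 1000 * \<beta>2 * \<beta> ^ 3 / (3 * \<alpha> ^ 3)"
  have "F (x (Suc t)) - F xs \<le> 2 * sqrt 2 / \<alpha> powr (3/2) * K * G powr (3/2)
    + 64 * \<beta>2 * C ^ 3 / (3 * \<alpha> ^ 6) * G ^ 3"
  proof (rule beta2_cases[OF xs_min(1)])
    assume "\<beta>2 \<ge> 0"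
    let ?\<rho> = "norm (x t - xs)"
    have growth: "?\<rho>\<^sup>2 \<le> 2 / \<alpha> * G" using quadratic_growth[OF y] by (simp add: G_def)
    have "F (x (Suc t)) - F xs \<le> K * ?\<rho> ^ 3 + 8 / 3 * \<beta>2 * C ^ 3 / \<alpha> ^ 3 * ?\<rho> ^ 6"
      using newton_iterates_decrease[OF iter dom \<open>t \<ge> 1\<close>] WPNO_gap[OF wpno y \<open>\<beta>2 \<ge> 0\<close>]
      unfolding K_def by linarith
    also have "\<dots> \<le> K * (2 * sqrt 2 / \<alpha> powr (3/2) * G powr (3/2))
        + 8 / 3 * \<beta>2 * C ^ 3 / \<alpha> ^ 3 * (2 / \<alpha> * G) ^ 3"
    proof (intro add_mono mult_left_mono)
      show "?\<rho> ^ 3 \<le> 2 * sqrt 2 / \<alpha> powr (3/2) * G powr (3/2)"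
        using alpha_pos growth by (intro cube_le_of_square_le) auto
      show "?\<rho> ^ 6 \<le> (2 / \<alpha> * G) ^ 3"
        using power_mono[OF growth, of 3] by (simp flip: power_mult)
    qed (use C \<open>\<beta>2 \<ge> 0\<close> alpha_pos beta_pos in \<open>auto simp: K_def\<close>)
    \<comment> \<open>The factor 64 is 8 from the relaxed coefficient times 8 from cubing
      \<open>2 / \<alpha>\<close>.\<close>
    also have "8 / 3 * \<beta>2 * C ^ 3 / \<alpha> ^ 3 * (2 / \<alpha> * G) ^ 3 = 64 * \<beta>2 * C ^ 3 / (3 * \<alpha> ^ 6) * G ^ 3"
      using alpha_pos by (simp add: field_simps power_mult_distrib flip: power_add)
    finally show ?thesis by (simp add: mult_ac)
  next
    assume "edom R = {xs}"
    then have "x t = xs" "x (Suc t) = xs" using yS y' by auto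
    then show ?thesis by (simp add: G_def)
  qed
  then show ?thesis
    by (simp add: gap_eq[OF is_arg_min_minimizer] yS y' G_def K_def)
qed

theorem theorem1:
  fixes f :: "'a::euclidean_space \<Rightarrow> real" and R :: "'a \<Rightarrow> ereal"
    and \<alpha> \<beta> \<beta>2 C :: real
    and \<A> :: "'a \<Rightarrow> real \<Rightarrow> 'a" and x :: "nat \<Rightarrow> 'a"
  assumes "composite_problem f R \<beta>2"
    and "newton_iterates f R \<A> x"
  shows
    "(((assumption_A f R (x 1) \<alpha> \<beta> \<or> assumption_B f R \<alpha>) \<and> WRPNO f R \<beta>2 C \<A>) \<longrightarrow>
       (\<forall>t\<ge>1. gap f R (x (Suc t)) \<le>
          ereal (2 * sqrt 2 / \<alpha> powr (3/2) * (C + \<beta>2 / 3)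
                 * real_of_ereal (gap f R (x t)) powr (3/2))))
     \<and>
     ((assumption_A f R (x 1) \<alpha> \<beta> \<and> WPNO f R C \<A>) \<longrightarrow>
       (\<forall>t\<ge>1. gap f R (x (Suc t)) \<le>
          ereal (2 * sqrt 2 / \<alpha> powr (3/2)
                   * (5 * \<beta>2 / 6 + C + 1000 * \<beta>2 * \<beta> ^ 3 / (3 * \<alpha> ^ 3))
                   * real_of_ereal (gap f R (x t)) powr (3/2)
                 + 64 * \<beta>2 * C ^ 3 / (3 * \<alpha> ^ 6) * real_of_ereal (gap f R (x t)) ^ 3)))"
proof -
  interpret composite f R \<beta>2 using assms(1) by unfold_locales
  \<comment> \<open>All that the regularized case takes from either assumption.\<close>
  have growth: "\<alpha> > 0 \<and> is_arg_min (objective f R) (\<lambda>_. True) (minimizer f R) \<and>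
    (\<forall>y\<in>edom R. F y \<le> F (x 1) \<longrightarrow>
      (norm (y - minimizer f R))\<^sup>2 \<le> 2 / \<alpha> * (F y - F (minimizer f R)))"
    if "assumption_A f R (x 1) \<alpha> \<beta> \<or> assumption_B f R \<alpha>"
    using that
  proof
    assume "assumption_A f R (x 1) \<alpha> \<beta>"
    then interpret strongly_convex_level f R \<beta>2 "x 1" \<alpha> \<beta> by unfold_locales
    show ?thesis using alpha_pos is_arg_min_minimizer quadratic_growth[unfolded L_iff] by blast
  next
    assume B: "assumption_B f R \<alpha>"
    then have min: "is_arg_min (objective f R) (\<lambda>_. True) (minimizer f R)"
      unfolding assumption_B_def minimizer_def arg_min_def by (blast intro: someI_ex)
    have "(norm (y - minimizer f R))\<^sup>2 \<le> 2 / \<alpha> * (F y - F (minimizer f R))" if "y \<in> edom R" for y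
    proof -
      have "ereal ((norm (y - minimizer f R))\<^sup>2) \<le> ereal (2 / \<alpha>) * gap f R y"
        using B that unfolding assumption_B_def gap_def by blast
      then show ?thesis by (simp add: gap_eq[OF min that])
    qed
    then show ?thesis using B min by (simp add: assumption_B_def)
  qed
  show ?thesis
  proof (intro conjI impI allI; elim conjE)
    fix t :: nat
    assume "1 \<le> t" "WRPNO f R \<beta>2 C \<A>" "assumption_A f R (x 1) \<alpha> \<beta> \<or> assumption_B f R \<alpha>"
    then show "gap f R (x (Suc t)) \<le> ereal (2 * sqrt 2 / \<alpha> powr (3/2) * (C + \<beta>2 / 3)
        * real_of_ereal (gap f R (x t)) powr (3/2))"
      using growth by (intro WRPNO_iterates_gap[OF assms(2)]) auto
  next
    fix t :: nat
    assume *: "1 \<le> t" "assumption_A f R (x 1) \<alpha> \<beta>" "WPNO f R C \<A>"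
    interpret strongly_convex_level f R \<beta>2 "x 1" \<alpha> \<beta> using *(2) by unfold_locales
    show "gap f R (x (Suc t)) \<le>
        ereal (2 * sqrt 2 / \<alpha> powr (3/2) * (5 * \<beta>2 / 6 + C + 1000 * \<beta>2 * \<beta> ^ 3 / (3 * \<alpha> ^ 3))
                 * real_of_ereal (gap f R (x t)) powr (3/2)
               + 64 * \<beta>2 * C ^ 3 / (3 * \<alpha> ^ 6) * real_of_ereal (gap f R (x t)) ^ 3)"
      by (rule WPNO_iterates_gap[OF assms(2) *(3) refl *(1)])
  qed
qed

end
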